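(* Let $h_0,h_1:\mathbb{R}\to\mathbb{R}$ preserve almost automorphy and let $C_1$ be an admissible kernel with constants $\alpha_1,N_1$ (both notions as defined in the context). Suppose that: (i) $f\in AA(\mathbb{R}\times\mathbb{X}\times\mathbb{X};\mathbb{X})$ and there is a continuous and bounded function $L_f:\mathbb{R}^+\to\mathbb{R}^+$ such that for all $r>0$, all $t\in\mathbb{R}$ and all $x,y,x_1,y_1\in B(0,r)=\{x\in\mathbb{X}:\|x\|\le r\}$, $$\|f(t,x,x_1)-f(t,y,y_1)\|\le L_f(r)\big(\|x-y\|+\|x_1-y_1\|\big);$$ (ii) $\displaystyle\sup_{r>0}\big(r-2rL_f(r)-2rN_1\big)>\alpha_1+\sup_{s\in\mathbb{R}}\|f(s,0,0)\| .$ Then the integral equation $$y(t)=f(t,y(t),y(h_0(t)))+\int_{-\infty}^{t}C_1(t,s,y(s),y(h_1(s)))\,ds,\quad t\in\mathbb{R},$$ has a unique almost automorphic solution.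
   Context: $\mathbb{X}$ is a Banach space; $\mathbb{R}^+=[0,+\infty)$. $AA(\mathbb{R};\mathbb{X})$ (almost automorphic functions): bounded continuous $f:\mathbb{R}\to\mathbb{X}$ such that every real sequence $(s_n')$ has a subsequence $(s_n)$ and there is a function $\tilde f$ with $\lim_n f(t+s_n)=\tilde f(t)$ and $\lim_n\tilde f(t-s_n)=f(t)$ for each $t\in\mathbb{R}$. $AA(\mathbb{R}\times\mathbb{Y};\mathbb{X})$ ($\mathbb{Y}$ a Banach space): bounded continuous $f:\mathbb{R}\times\mathbb{Y}\to\mathbb{X}$ such that for every bounded $\mathcal{B}\subset\mathbb{Y}$ and every real sequence $(s_n')$ there are a subsequence $(s_n)$ and a function $\tilde f$ with $\lim_n f(t+s_n,x)=\tilde f(t,x)$ and $\lim_n\tilde f(t-s_n,x)=f(t,x)$, pointwise in $t\in\mathbb{R}$ and uniformly for $x\in\mathcal{B}$. Bi-almost automorphic: a jointly continuous $C:\mathbb{R}\times\mathbb{R}\times\mathbb{X}\times\mathbb{X}\to\mathbb{X}$ such that for every real sequence and every bounded $\mathcal{B}\subset\mathbb{X}\times\mathbb{X}$ there is a subsequence $(s_n)$ with $\tilde C(t,s,x,y):=\lim_n C(t+s_n,s+s_n,x,y)$ existing and $\lim_n\tilde C(t-s_n,s-s_n,x,y)=C(t,s,x,y)$, for each $(t,s)\in\mathbb{R}^2$ and uniformly for $(x,y)\in\mathcal{B}$. Such $\tilde C$ are called limit functions of $C$. $\lambda$-bounded: there is a positive function $\lambda:\mathbb{R}\times\mathbb{R}\to\mathbb{R}$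 such that $\|C(t+\tau,s+\tau,x,y)\|\le\lambda(t,s)$ for all $t,s,\tau\in\mathbb{R}$, uniformly for $(x,y)$ in bounded subsets of $\mathbb{X}\times\mathbb{X}$ (the same $\lambda$ for all bounded subsets). $(\mu,\tilde\mu)$-Lipschitz: there are functions $\mu,\tilde\mu:\mathbb{R}\times\mathbb{R}\to[0,\infty)$ such that, for $(u_1,u_2),(v_1,v_2)$ in bounded subsets of $\mathbb{X}\times\mathbb{X}$, $\|C(t,s,u_1,u_2)-C(t,s,v_1,v_2)\|\le\mu(t,s)(\|u_1-v_1\|+\|u_2-v_2\|)$, and the same holds with $\tilde C$ (the limit functions), $\tilde\mu$ in place of $C,\mu$. $h_0,h_1$ preserve almost automorphy: $y\in AA(\mathbb{R};\mathbb{X})$ implies $y(h_i(\cdot))\in AA(\mathbb{R};\mathbb{X})$ for $i=0,1$. Admissible kernel with constants $\alpha_1,N_1$: $C_1:\mathbb{R}\times\mathbb{R}\times\mathbb{X}\times\mathbb{X}\to\mathbb{X}$ is Bi-almost automorphic, $\lambda_1$-bounded and $(\mu_1,\tilde\mu_1)$-Lipschitz, with $\alpha_1=\sup_t\int_{-\infty}^t\lambda_1(t,s)ds<\infty$ and $N_1=\sup_t\int_{-\infty}^t\mu_1(t,s)ds<\infty$.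
   Formalization: Uniqueness among all almost automorphic solutions can fail under (i)-(ii), so what is proved is existence, plus uniqueness among almost automorphic solutions with ‖y(t)‖ ≤ r for all t, for every r>0 with r-2rL_f(r)-2rN_1 > α_1+sup‖f(s,0,0)‖. *)

theory Defs
  imports "HOL-Analysis.Analysis"
begin

definition almost_automorphic :: "(real \<Rightarrow> 'a::banach) \<Rightarrow> bool" where
  "almost_automorphic f \<longleftrightarrow>
     continuous_on UNIV f \<and> bounded (range f) \<and>
     (\<forall>s' :: nat \<Rightarrow> real. \<exists>\<sigma> :: nat \<Rightarrow> nat. \<exists>ft. strict_mono \<sigma> \<and>
        (\<forall>t. (\<lambda>n. f (t + s' (\<sigma> n))) \<longlonglongrightarrow> ft t) \<and>
        (\<forall>t. (\<lambda>n. ft (t - s' (\<sigma> n))) \<longlonglongrightarrow> f t))"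

definition almost_automorphic_param :: "(real \<times> 'y::banach \<Rightarrow> 'a::banach) \<Rightarrow> bool" where
  "almost_automorphic_param f \<longleftrightarrow>
     continuous_on UNIV f \<and> bounded (range f) \<and>
     (\<forall>B. bounded B \<longrightarrow> (\<forall>s' :: nat \<Rightarrow> real. \<exists>\<sigma> :: nat \<Rightarrow> nat. \<exists>ft. strict_mono \<sigma> \<and>
        (\<forall>t. uniform_limit B (\<lambda>n x. f (t + s' (\<sigma> n), x)) (\<lambda>x. ft (t, x)) sequentially) \<and>
        (\<forall>t. uniform_limit B (\<lambda>n x. ft (t - s' (\<sigma> n), x)) (\<lambda>x. f (t, x)) sequentially)))"

text \<open>\<open>limit_function_on B s C Ct\<close>: on the set \<open>B\<close>, the function \<open>Ct\<close> is the limit function of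
  \<open>C\<close> along the sequence \<open>s\<close>. The values of \<open>Ct\<close> at points outside \<open>B\<close> are irrelevant.\<close>

definition limit_function_on ::
  "('a \<times> 'a) set \<Rightarrow> (nat \<Rightarrow> real) \<Rightarrow> (real \<times> real \<times> 'a \<times> 'a \<Rightarrow> 'a::banach) \<Rightarrow>
     (real \<times> real \<times> 'a \<times> 'a \<Rightarrow> 'a) \<Rightarrow> bool" where
  "limit_function_on B s C Ct \<longleftrightarrow>
     (\<forall>t \<tau>. uniform_limit B (\<lambda>n p. C (t + s n, \<tau> + s n, p)) (\<lambda>p. Ct (t, \<tau>, p)) sequentially) \<and>
     (\<forall>t \<tau>. uniform_limit B (\<lambda>n p. Ct (t - s n, \<tau> - s n, p)) (\<lambda>p. C (t, \<tau>, p)) sequentially)"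

definition bi_almost_automorphic :: "(real \<times> real \<times> 'a \<times> 'a \<Rightarrow> 'a::banach) \<Rightarrow> bool" where
  "bi_almost_automorphic C \<longleftrightarrow>
     continuous_on UNIV C \<and>
     (\<forall>s' :: nat \<Rightarrow> real. \<forall>B. bounded B \<longrightarrow>
        (\<exists>\<sigma> :: nat \<Rightarrow> nat. \<exists>Ct. strict_mono \<sigma> \<and> limit_function_on B (s' \<circ> \<sigma>) C Ct))"

definition lambda_bounded ::
  "(real \<Rightarrow> real \<Rightarrow> real) \<Rightarrow> (real \<times> real \<times> 'a \<times> 'a \<Rightarrow> 'a::banach) \<Rightarrow> bool" where
  "lambda_bounded lam C \<longleftrightarrow>
     (\<forall>t s. 0 < lam t s) \<and>
     (\<forall>B. bounded B \<longrightarrow>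
        (\<forall>t s \<tau>. \<forall>(x, y) \<in> B. norm (C (t + \<tau>, s + \<tau>, x, y)) \<le> lam t s))"

definition mu_lipschitz ::
  "(real \<Rightarrow> real \<Rightarrow> real) \<Rightarrow> (real \<Rightarrow> real \<Rightarrow> real) \<Rightarrow>
     (real \<times> real \<times> 'a \<times> 'a \<Rightarrow> 'a::banach) \<Rightarrow> bool" where
  "mu_lipschitz \<mu> \<mu>t C \<longleftrightarrow>
     (\<forall>t s. 0 \<le> \<mu> t s) \<and> (\<forall>t s. 0 \<le> \<mu>t t s) \<and>
     (\<forall>B. bounded B \<longrightarrow>
        (\<forall>t s. \<forall>(u1, u2) \<in> B. \<forall>(v1, v2) \<in> B.
           norm (C (t, s, u1, u2) - C (t, s, v1, v2))
             \<le> \<mu> t s * (norm (u1 - v1) + norm (u2 - v2))) \<and>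
        (\<forall>\<sigma> Ct. limit_function_on B \<sigma> C Ct \<longrightarrow>
          (\<forall>t s. \<forall>(u1, u2) \<in> B. \<forall>(v1, v2) \<in> B.
             norm (Ct (t, s, u1, u2) - Ct (t, s, v1, v2))
               \<le> \<mu>t t s * (norm (u1 - v1) + norm (u2 - v2)))))"

text \<open>The constant \<open>c\<close> is the supremum over \<open>t\<close>, assumed finite, of the integrals of \<open>k t\<close> over
  \<open>(-\<infinity>, t]\<close>. The boundedness conjunct is needed because the supremum of an unbounded set of
  reals is unspecified.\<close>

definition is_kernel_constant :: "(real \<Rightarrow> real \<Rightarrow> real) \<Rightarrow> real \<Rightarrow> bool" where
  "is_kernel_constant k c \<longleftrightarrow>
     (\<forall>t. k t integrable_on {..t}) \<and>
     bdd_above (range (\<lambda>t. integral {..t} (k t))) \<and>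
     c = (SUP t. integral {..t} (k t))"

definition admissible_kernel ::
  "(real \<times> real \<times> 'a \<times> 'a \<Rightarrow> 'a::banach) \<Rightarrow> real \<Rightarrow> real \<Rightarrow> bool" where
  "admissible_kernel C \<alpha> N \<longleftrightarrow>
     bi_almost_automorphic C \<and>
     (\<exists>lam \<mu> \<mu>t. lambda_bounded lam C \<and> mu_lipschitz \<mu> \<mu>t C \<and>
        is_kernel_constant lam \<alpha> \<and> is_kernel_constant \<mu> N)"

text \<open>The Bochner integral of the library is only available for second countable spaces, whereas
  the gauge integral exists in every Banach space. For almost automorphic \<open>y\<close> and \<open>y \<circ> h1\<close> and
  an admissible kernel the integrand is continuous in \<open>s\<close> and its norm is dominated by an
  integrable function, so that the two integrals agree.\<close>

definition solves_integral_equation ::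
  "(real \<times> 'a \<times> 'a \<Rightarrow> 'a) \<Rightarrow> (real \<times> real \<times> 'a \<times> 'a \<Rightarrow> 'a) \<Rightarrow> (real \<Rightarrow> real) \<Rightarrow>
     (real \<Rightarrow> real) \<Rightarrow> (real \<Rightarrow> 'a::banach) \<Rightarrow> bool" where
  "solves_integral_equation f C h0 h1 y \<longleftrightarrow>
     (\<forall>t. (\<lambda>s. C (t, s, y s, y (h1 s))) integrable_on {..t} \<and>
          y t = f (t, y t, y (h0 t)) + integral {..t} (\<lambda>s. C (t, s, y s, y (h1 s))))"

end

theory Submission imports Defs "HOL-Library.Diagonal_Subsequence" begin

text \<open>The right-hand side of the equation defines an operator \<open>\<Gamma>\<close> on almost automorphic functions.
  On those bounded by \<open>r\<close>, it is a contraction with constant \<open>c = 2 (L\<^sub>f r + N\<^sub>1)\<close>, since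
  \<open>r (1 - c) > \<alpha>\<^sub>1 + sup \<parallel>f(s, 0, 0)\<parallel> \<ge> 0\<close>, and the same inequality gives invariance. These functions form
  a complete space for the supremum norm, so the Banach fixed point theorem applies. The integral
  is almost automorphic because \<open>C\<^sub>1 (t, s + t, \<dots>)\<close> is dominated on \<open>{..0}\<close> by \<open>\<lambda>\<^sub>1 0 s\<close> for every \<open>t\<close>.\<close>

section \<open>Gauge integrals over half-lines: translation and domination\<close>

text \<open>An interval containing the ball of radius B + |c| still contains the ball of radius B
  after translation by c, so a cutoff radius for f gives one for the shifted function.\<close>

lemma has_integral_shift_UNIV:
  fixes f :: "real \<Rightarrow> 'b::banach"
  assumes "(f has_integral I) UNIV"
  shows "((\<lambda>x. f (x + c)) has_integral I) UNIV"
proof (subst has_integral', intro allI impI)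
  fix e :: real assume "e > 0"
  then obtain B where B: "B > 0"
    and I: "\<And>a b. ball 0 B \<subseteq> cbox a b \<Longrightarrow> \<exists>z. (f has_integral z) (cbox a b) \<and> norm (z - I) < e"
    using assms[unfolded has_integral'[of f I UNIV]] by auto
  have "\<exists>z. ((\<lambda>x. f (x + c)) has_integral z) (cbox a b) \<and> norm (z - I) < e"
    if ab: "ball 0 (B + \<bar>c\<bar>) \<subseteq> cbox a b" for a b
  proof -
    have "ball 0 B \<subseteq> cbox (a + c) (b + c)"
    proof
      fix x :: real assume "x \<in> ball 0 B"
      then have "x - c \<in> ball 0 (B + \<bar>c\<bar>)" by (auto simp: dist_norm)
      then show "x \<in> cbox (a + c) (b + c)" using ab by auto
    qed
    then show ?thesis
      using I[of "a + c" "b + c"] has_integral_shift_cbox_iff[of f c _ a b]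
      by (auto simp: o_def add.commute)
  qed
  then show "\<exists>B>0. \<forall>a b. ball 0 B \<subseteq> cbox a b \<longrightarrow>
      (\<exists>z. ((\<lambda>x. if x \<in> UNIV then f (x + c) else 0) has_integral z) (cbox a b) \<and> norm (z - I) < e)"
    using B by (intro exI[of _ "B + \<bar>c\<bar>"]) auto
qed

lemma has_integral_shift_atMost:
  fixes f :: "real \<Rightarrow> 'b::banach"
  assumes "((\<lambda>s. f (s + t)) has_integral I) {..0}"
  shows "(f has_integral I) {..t}"
proof -
  have "((\<lambda>s. if s + (-t) \<in> {..0} then f (s + (-t) + t) else 0) has_integral I) UNIV"
    using assms by (intro has_integral_shift_UNIV) (simp only: has_integral_restrict_UNIV)
  then have "((\<lambda>s. if s \<in> {..t} then f s else 0) has_integral I) UNIV"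
    by (simp cong: if_cong)
  then show ?thesis by (simp only: has_integral_restrict_UNIV)
qed

text \<open>Continuity gives integrability on compact intervals. The Cauchy criterion at infinity is
  inherited from k, because the pieces by which two truncated integrals of g differ are bounded by
  those of k.\<close>

lemma integrable_continuous_dominated_atMost:
  fixes g :: "real \<Rightarrow> 'b::banach"
  assumes g: "continuous_on {..c} g" and k: "k integrable_on {..c}"
    and le: "\<And>s. s \<le> c \<Longrightarrow> norm (g s) \<le> k s"
  shows "g integrable_on {..c}"
proof -
  have cut: "{a..b} \<inter> {..c} = {a..min b c}" for a b :: real by auto
  have g_Icc: "g integrable_on {a..b}" if "b \<le> c" for a b
    using g that by (intro integrable_continuous_interval continuous_on_subset[OF g]) auto
  have k_Icc: "k integrable_on {a..b}" if "b \<le> c" for a b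
    using that by (intro integrable_on_subinterval[OF k]) auto
  have 1: "(\<lambda>x. if x \<in> {..c} then g x else 0) integrable_on cbox a b" for a b
    by (simp only: integrable_restrict_Int) (simp add: Int_commute[of "{..c}"] cut g_Icc)
  have 2: "\<exists>B>0. \<forall>a b a' b'. ball 0 B \<subseteq> cbox a b \<and> ball 0 B \<subseteq> cbox a' b' \<longrightarrow>
    norm (integral (cbox a b) (\<lambda>x. if x \<in> {..c} then g x else 0) -
      integral (cbox a' b') (\<lambda>x. if x \<in> {..c} then g x else 0)) < e" if "e > 0" for e
  proof -
    from integrable_altD(2)[OF k \<open>e > 0\<close>] obtain B where B: "B > 0"
      and kB: "\<forall>a b a' b'. ball 0 B \<subseteq> cbox a b \<and> ball 0 B \<subseteq> cbox a' b' \<longrightarrow>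
        norm (integral (cbox a b) (\<lambda>x. if x \<in> {..c} then k x else 0) -
          integral (cbox a' b') (\<lambda>x. if x \<in> {..c} then k x else 0)) < e"
      by (elim exE conjE) (rule that)
    \<comment> \<open>An interval around the ball of radius R also contains c. Cut at c, it becomes
      \<open>{a..c}\<close>, so two truncations differ only in their lower ends.\<close>
    define R where "R = B + \<bar>c\<bar> + 1"
    have sub: "ball 0 B \<subseteq> cbox a b \<and> a \<le> c \<and> c \<le> b" if "ball 0 R \<subseteq> cbox a b" for a b :: real
    proof -
      have "c \<in> ball 0 R" "ball 0 B \<subseteq> ball (0::real) R"
        using B by (auto simp: R_def dist_norm)
      then show ?thesis using that by auto
    qed
    have cut': "integral (cbox a b) (\<lambda>x. if x \<in> {..c} then h x else 0) = integral {a..c} h"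
      if "c \<le> b" for a b :: real and h :: "real \<Rightarrow> 'd::banach"
      using that by (simp only: integral_restrict_Int) (simp add: Int_commute[of "{..c}"] cut)
    \<comment> \<open>Both differences are integrals over \<open>{a..a'}\<close>, where the one of g
      is bounded by the one of k.\<close>
    have key: "norm (integral {a..c} g - integral {a'..c} g) < e"
      if "a \<le> a'" "a' \<le> c" and lt: "norm (integral {a..c} k - integral {a'..c} k) < e" for a a'
    proof -
      have "integral {a..c} g = integral {a..a'} g + integral {a'..c} g"
        using Henstock_Kurzweil_Integration.integral_combine[where a = a and b = c and c = a' and f = g] that g_Icc by simp
      moreover have "integral {a..c} k = integral {a..a'} k + integral {a'..c} k"
        using Henstock_Kurzweil_Integration.integral_combine[where a = a and b = c and c = a' and f = k] that k_Icc by simp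
      moreover have "norm (integral {a..a'} g) \<le> integral {a..a'} k"
        using that by (intro integral_norm_bound_integral g_Icc k_Icc le) auto
      ultimately show ?thesis using lt by simp
    qed
    show ?thesis
    proof (intro exI[of _ R] conjI allI impI)
      show "R > 0" using B by (simp add: R_def)
      fix a b a' b' :: real assume "ball 0 R \<subseteq> cbox a b \<and> ball 0 R \<subseteq> cbox a' b'"
      then have s: "ball 0 B \<subseteq> cbox a b" "a \<le> c" "c \<le> b" "ball 0 B \<subseteq> cbox a' b'" "a' \<le> c" "c \<le> b'"
        using sub by auto
      have lt: "norm (integral {a..c} k - integral {a'..c} k) < e"
        using kB[rule_format, OF conjI[OF s(1,4)]] s by (simp only: cut')
      have "norm (integral {a..c} g - integral {a'..c} g) < e"
      proof (cases "a \<le> a'")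
        case True
        then show ?thesis using key s lt by blast
      next
        case False
        then show ?thesis using key[of a' a] s lt by (simp add: norm_minus_commute)
      qed
      then show "norm (integral (cbox a b) (\<lambda>x. if x \<in> {..c} then g x else 0) -
        integral (cbox a' b') (\<lambda>x. if x \<in> {..c} then g x else 0)) < e"
        using s by (simp only: cut')
    qed
  qed
  show ?thesis by (subst integrable_alt, intro conjI allI impI) (rule 1, rule 2)
qed

text \<open>Continuity of \<open>g'\<close> makes it integrable, so the error is at most the
  integral of the norm of \<open>g n - g'\<close>. This is a real integrand dominated by 2k, to
  which scalar dominated convergence applies.\<close>

lemma integral_tendsto_dominated_atMost:
  fixes g :: "nat \<Rightarrow> real \<Rightarrow> 'b::banach"
  assumes g: "\<And>n. continuous_on {..c} (g n)" and g': "continuous_on {..c} g'"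
    and k: "k integrable_on {..c}"
    and le: "\<And>n s. s \<le> c \<Longrightarrow> norm (g n s) \<le> k s"
    and lim: "\<And>s. s \<le> c \<Longrightarrow> (\<lambda>n. g n s) \<longlonglongrightarrow> g' s"
  shows "(\<lambda>n. integral {..c} (g n)) \<longlonglongrightarrow> integral {..c} g'"
proof -
  have le': "norm (g' s) \<le> k s" if "s \<le> c" for s
    by (rule Lim_bounded[OF tendsto_norm[OF lim[OF that]], of 0]) (simp add: le that)
  have int: "g n integrable_on {..c}" "g' integrable_on {..c}" for n
    using integrable_continuous_dominated_atMost[OF g k le]
      integrable_continuous_dominated_atMost[OF g' k le'] by auto
  have le2: "norm (g n s - g' s) \<le> 2 * k s" if "s \<le> c" for n s
    using le[OF that] le'[OF that] norm_triangle_ineq4[of "g n s" "g' s"] by (smt (verit))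
  have k2: "(\<lambda>s. 2 * k s) integrable_on {..c}" using k by (rule integrable_on_mult_right)
  have dint: "(\<lambda>s. norm (g n s - g' s)) integrable_on {..c}" for n
    by (intro integrable_continuous_dominated_atMost[OF _ k2] continuous_intros g g') (simp add: le2)
  have "(\<lambda>n. integral {..c} (\<lambda>s. norm (g n s - g' s))) \<longlonglongrightarrow> integral {..c} (\<lambda>s. 0)"
  proof (rule dominated_convergence(2)[OF dint k2])
    show "norm (norm (g n s - g' s)) \<le> 2 * k s" if "s \<in> {..c}" for n s using le2 that by simp
    show "(\<lambda>n. norm (g n s - g' s)) \<longlonglongrightarrow> 0" if "s \<in> {..c}" for s
      using lim[of s] that by (simp add: tendsto_norm_zero_iff Lim_null[symmetric])
  qed
  then have "(\<lambda>n. integral {..c} (\<lambda>s. norm (g n s - g' s))) \<longlonglongrightarrow> 0" by simp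
  then have "(\<lambda>n. integral {..c} (g n) - integral {..c} g') \<longlonglongrightarrow> 0"
  proof (rule Lim_null_comparison[rotated], intro always_eventually allI)
    show "norm (integral {..c} (g n) - integral {..c} g') \<le> integral {..c} (\<lambda>s. norm (g n s - g' s))" for n
      by (subst integral_diff[symmetric, OF int])
        (intro integral_norm_bound_integral integrable_diff int dint order_refl)
  qed
  then show ?thesis by (simp add: Lim_null[symmetric])
qed

section \<open>Two-sided translation limits and their passage through the integral\<close>

text \<open>The sequence is a parameter so that several functions can be handled along one common
  subsequence.\<close>

definition aa_limit :: "(nat \<Rightarrow> real) \<Rightarrow> (real \<Rightarrow> 'b::metric_space) \<Rightarrow> (real \<Rightarrow> 'b) \<Rightarrow> bool" where
  "aa_limit s f ft \<longleftrightarrow> (\<forall>t. (\<lambda>n. f (t + s n)) \<longlonglongrightarrow> ft t) \<and> (\<forall>t. (\<lambda>n. ft (t - s n)) \<longlonglongrightarrow> f t)"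

text \<open>The functions \<open>gt t\<close> are mere pointwise limits with values in a possibly nonseparable space,
  so their integrability is not available. Hence the limit function is obtained from completeness, and
  dominated convergence is only applied to the real functions given by the norms of differences.\<close>

lemma aa_limit_integral:
  fixes g :: "real \<Rightarrow> real \<Rightarrow> 'b::banach"
  assumes g: "\<And>t. continuous_on {..c} (g t)" and k: "k integrable_on {..c}"
    and le: "\<And>t s. s \<le> c \<Longrightarrow> norm (g t s) \<le> k s"
    and lim: "\<And>s. s \<le> c \<Longrightarrow> aa_limit \<sigma> (\<lambda>t. g t s) (\<lambda>t. gt t s)"
  shows "\<exists>G. aa_limit \<sigma> (\<lambda>t. integral {..c} (g t)) G"
proof -
  define I where "I t = integral {..c} (g t)" for t
  have int: "g t integrable_on {..c}" for t
    by (rule integrable_continuous_dominated_atMost[OF g k le])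
  have k2: "(\<lambda>s. 2 * k s) integrable_on {..c}" using k by (rule integrable_on_mult_right)
  have lim1: "(\<lambda>n. g (t + \<sigma> n) s) \<longlonglongrightarrow> gt t s" if "s \<le> c" for t s
    using lim[OF that] by (simp add: aa_limit_def)
  have lim2: "(\<lambda>n. gt (t - \<sigma> n) s) \<longlonglongrightarrow> g t s" if "s \<le> c" for t s
    using lim[OF that] by (simp add: aa_limit_def)
  have gt: "norm (gt t s) \<le> k s" if "s \<le> c" for t s
    by (rule Lim_bounded[OF tendsto_norm[OF lim1[OF that]], of 0]) (simp add: le that)
  have le2: "norm (x - y) \<le> 2 * k s" if "norm x \<le> k s" "norm y \<le> k s" for x y :: 'b and s
    using that norm_triangle_ineq4[of x y] by simp
  have dint: "(\<lambda>s. norm (g t s - g u s)) integrable_on {..c}" for t u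
    by (intro integrable_continuous_dominated_atMost[OF _ k2] continuous_intros g) (simp add: le2 le)
  have dist_I: "norm (I t - I u) \<le> integral {..c} (\<lambda>s. norm (g t s - g u s))" for t u
    unfolding I_def by (subst integral_diff[symmetric, OF int int])
        (intro integral_norm_bound_integral integrable_diff int dint order_refl)
  \<comment> \<open>This is how \<open>gt\<close> gets under an integral sign: the norm is a
    pointwise limit of dominated continuous real functions, so scalar dominated convergence yields
    its integrability as well.\<close>
  have D: "(\<lambda>s. norm (gt t s - g u s)) integrable_on {..c} \<and>
    (\<lambda>n. integral {..c} (\<lambda>s. norm (g (t + \<sigma> n) s - g u s))) \<longlonglongrightarrow>
      integral {..c} (\<lambda>s. norm (gt t s - g u s))" for t u
    by (intro conjI dominated_convergence[OF dint k2] tendsto_intros)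
      (auto intro!: le2 le lim1)
  have Cauchy: "Cauchy (\<lambda>n. I (t + \<sigma> n))" for t
  proof -
    \<comment> \<open>\<open>E n\<close> is the mean distance from the integrand at time
      \<open>t + \<sigma> n\<close> to its pointwise limit. The triangle inequality through
      \<open>gt t\<close> turns \<open>E \<longlonglongrightarrow> 0\<close> into the Cauchy
      property.\<close>
    define E where "E n = integral {..c} (\<lambda>s. norm (gt t s - g (t + \<sigma> n) s))" for n
    have "E \<longlonglongrightarrow> integral {..c} (\<lambda>s. 0)"
      unfolding E_def
    proof (rule dominated_convergence(2)[OF conjunct1[OF D] k2])
      show "(\<lambda>n. norm (gt t s - g (t + \<sigma> n) s)) \<longlonglongrightarrow> 0" if "s \<in> {..c}" for s
        using lim1[of s t] that tendsto_norm[OF tendsto_diff[OF tendsto_const lim1[of s t]], of "gt t s"]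
        by simp
    qed (auto intro!: le2 le gt)
    then have E: "E \<longlonglongrightarrow> 0" by simp
    have IE: "norm (I (t + \<sigma> m) - I (t + \<sigma> n)) \<le> E m + E n" for m n
    proof -
      have "norm (I (t + \<sigma> m) - I (t + \<sigma> n)) \<le>
          integral {..c} (\<lambda>s. norm (g (t + \<sigma> m) s - g (t + \<sigma> n) s))"
        by (rule dist_I)
      also have "\<dots> \<le> integral {..c} (\<lambda>s. norm (gt t s - g (t + \<sigma> m) s) + norm (gt t s - g (t + \<sigma> n) s))"
        by (intro integral_le dint integrable_add conjunct1[OF D]) (simp add: dist_norm[symmetric] dist_triangle3)
      also have "\<dots> = E m + E n"
        unfolding E_def by (intro integral_add conjunct1[OF D])
      finally show ?thesis .
    qed
    show ?thesis
    proof (rule CauchyI)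
      fix e :: real assume "e > 0"
      then obtain M where M: "\<And>n. n \<ge> M \<Longrightarrow> E n < e/2"
        using order_tendstoD(2)[OF E, of "e/2"] by (auto simp: eventually_sequentially)
      have "norm (I (t + \<sigma> m) - I (t + \<sigma> n)) < e" if "m \<ge> M" "n \<ge> M" for m n
        using IE[of m n] M that by (smt (verit) field_sum_of_halves)
      then show "\<exists>M. \<forall>m\<ge>M. \<forall>n\<ge>M. norm (I (t + \<sigma> m) - I (t + \<sigma> n)) < e" by blast
    qed
  qed
  define G where "G t = lim (\<lambda>n. I (t + \<sigma> n))" for t
  have G: "(\<lambda>n. I (t + \<sigma> n)) \<longlonglongrightarrow> G t" for t
    using Cauchy[of t] by (simp add: G_def convergent_LIMSEQ_iff[symmetric] Cauchy_convergent_iff)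
  \<comment> \<open>This is \<open>dist_I\<close> at \<open>t + \<sigma> n\<close> in the limit.
    Applied below to \<open>t - \<sigma> n\<close> and u = t, it reduces the backward limit of G to
    that of \<open>gt\<close>.\<close>
  have GI: "norm (G t - I u) \<le> integral {..c} (\<lambda>s. norm (gt t s - g u s))" for t u
  proof (rule tendsto_le[OF sequentially_bot conjunct2[OF D]])
    show "(\<lambda>n. norm (I (t + \<sigma> n) - I u)) \<longlonglongrightarrow> norm (G t - I u)"
      by (intro tendsto_intros G)
  qed (simp add: dist_I)
  have "(\<lambda>n. G (t - \<sigma> n) - I t) \<longlonglongrightarrow> 0" for t
  proof (rule Lim_null_comparison[OF always_eventually[rule_format, OF GI]])
    have "(\<lambda>n. integral {..c} (\<lambda>s. norm (gt (t - \<sigma> n) s - g t s))) \<longlonglongrightarrow> integral {..c} (\<lambda>s. 0)"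
    proof (rule dominated_convergence(2)[OF conjunct1[OF D] k2])
      show "(\<lambda>n. norm (gt (t - \<sigma> n) s - g t s)) \<longlonglongrightarrow> 0" if "s \<in> {..c}" for s
        using lim2[of s t] that by (simp add: tendsto_norm_zero_iff Lim_null[symmetric])
    qed (auto intro!: le2 le gt)
    then show "(\<lambda>n. integral {..c} (\<lambda>s. norm (gt (t - \<sigma> n) s - g t s))) \<longlonglongrightarrow> 0" by simp
  qed
  then have "(\<lambda>n. G (t - \<sigma> n)) \<longlonglongrightarrow> I t" for t by (simp add: Lim_null[symmetric])
  with G show ?thesis unfolding aa_limit_def I_def[symmetric] by blast
qed

section \<open>Closure properties of almost automorphic functions\<close>

lemma aa_limit_subseq:
  assumes "aa_limit s f ft" "strict_mono r"
  shows "aa_limit (s \<circ> r) f ft"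
  using assms LIMSEQ_subseq_LIMSEQ[OF _ assms(2)] by (fastforce simp: aa_limit_def o_def)

lemma almost_automorphic_iff:
  "almost_automorphic f \<longleftrightarrow> continuous_on UNIV f \<and> bounded (range f) \<and>
    (\<forall>s. \<exists>\<sigma> :: nat \<Rightarrow> nat. strict_mono \<sigma> \<and> (\<exists>ft. aa_limit (s \<circ> \<sigma>) f ft))"
  by (simp add: almost_automorphic_def aa_limit_def)

lemma aa_limit_norm_le:
  fixes f :: "real \<Rightarrow> 'b::real_normed_vector"
  assumes "aa_limit s f ft" "\<And>t. norm (f t) \<le> r"
  shows "norm (ft t) \<le> r"
  using assms(1) by (intro Lim_norm_ubound[of sequentially "\<lambda>n. f (t + s n)"]) (auto simp: aa_limit_def assms(2))

lemma aa_limit_Pair: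
  assumes "aa_limit s f ft" "aa_limit s g gt"
  shows "aa_limit s (\<lambda>t. (f t, g t)) (\<lambda>t. (ft t, gt t))"
  using assms by (auto simp: aa_limit_def intro!: tendsto_Pair)

lemma aa_limit_add:
  fixes f g :: "real \<Rightarrow> 'b::real_normed_vector"
  assumes "aa_limit s f ft" "aa_limit s g gt"
  shows "aa_limit s (\<lambda>t. f t + g t) (\<lambda>t. ft t + gt t)"
  using assms by (auto simp: aa_limit_def intro!: tendsto_add)

lemma almost_automorphic_common_subseq:
  assumes "almost_automorphic f" "almost_automorphic g"
  obtains \<sigma> :: "nat \<Rightarrow> nat" and ft gt where "strict_mono \<sigma>" "aa_limit (s \<circ> \<sigma>) f ft" "aa_limit (s \<circ> \<sigma>) g gt"
proof -
  obtain \<sigma> ft where \<sigma>: "strict_mono \<sigma>" "aa_limit (s \<circ> \<sigma>) f ft"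
    using assms(1) unfolding almost_automorphic_iff by blast
  obtain \<rho> gt where \<rho>: "strict_mono \<rho>" "aa_limit ((s \<circ> \<sigma>) \<circ> \<rho>) g gt"
    using assms(2) unfolding almost_automorphic_iff by blast
  show ?thesis
    using that[of "\<sigma> \<circ> \<rho>" ft gt] aa_limit_subseq[OF \<sigma>(2) \<rho>(1)] \<rho> \<sigma>(1)
    by (simp add: comp_assoc strict_mono_o)
qed

lemma almost_automorphic_Pair:
  assumes "almost_automorphic f" "almost_automorphic g"
  shows "almost_automorphic (\<lambda>t. (f t, g t))"
  unfolding almost_automorphic_iff
proof (intro conjI allI)
  show "continuous_on UNIV (\<lambda>t. (f t, g t))"
    using assms by (intro continuous_on_Pair) (auto simp: almost_automorphic_iff)
  have "bounded (range f \<times> range g)"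
    using assms by (intro bounded_Times) (auto simp: almost_automorphic_iff)
  then show "bounded (range (\<lambda>t. (f t, g t)))" by (rule bounded_subset) auto
  show "\<exists>\<sigma> :: nat \<Rightarrow> nat. strict_mono \<sigma> \<and> (\<exists>ft. aa_limit (s \<circ> \<sigma>) (\<lambda>t. (f t, g t)) ft)" for s
    using almost_automorphic_common_subseq[OF assms, of s] aa_limit_Pair by metis
qed

lemma almost_automorphic_add:
  assumes "almost_automorphic f" "almost_automorphic g"
  shows "almost_automorphic (\<lambda>t. f t + g t)"
  unfolding almost_automorphic_iff
proof (intro conjI allI)
  show "continuous_on UNIV (\<lambda>t. f t + g t)"
    using assms by (intro continuous_on_add) (auto simp: almost_automorphic_iff)
  show "bounded (range (\<lambda>t. f t + g t))"
    using assms by (intro bounded_plus_comp) (auto simp: almost_automorphic_iff)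
  show "\<exists>\<sigma> :: nat \<Rightarrow> nat. strict_mono \<sigma> \<and> (\<exists>ft. aa_limit (s \<circ> \<sigma>) (\<lambda>t. f t + g t) ft)" for s
    using almost_automorphic_common_subseq[OF assms, of s] aa_limit_add by metis
qed

lemma almost_automorphic_const: "almost_automorphic (\<lambda>t. c)"
  by (auto simp: almost_automorphic_def intro!: exI[of _ id] exI[of _ "\<lambda>t. c"] strict_mono_id)

text \<open>A diagonal subsequence serves all \<open>F k\<close> at once. Their limit functions
  inherit the uniform Cauchy property, and the uniform limit of these is the limit function of f.
  This gives completeness of the space in which the fixed point is sought.\<close>

lemma almost_automorphic_uniform_limit:
  fixes F :: "nat \<Rightarrow> real \<Rightarrow> 'b::banach"
  assumes F: "\<And>k. almost_automorphic (F k)" and lim: "uniform_limit UNIV F f sequentially"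
  shows "almost_automorphic f"
  unfolding almost_automorphic_iff
proof (intro conjI allI)
  show "continuous_on UNIV f"
    using F by (intro uniform_limit_theorem[OF _ lim]) (auto simp: almost_automorphic_iff)
  show "bounded (range f)"
    using F by (intro uniform_limit_bounded[OF lim]) (auto simp: almost_automorphic_iff)
  fix s :: "nat \<Rightarrow> real"
  define P where "P k \<sigma> \<longleftrightarrow> (\<exists>ft. aa_limit (s \<circ> \<sigma>) (F k) ft)" for k \<sigma>
  interpret subseqs P
  proof
    fix k and \<sigma> :: "nat \<Rightarrow> nat" assume "strict_mono \<sigma>"
    then show "\<exists>r. strict_mono r \<and> P k (\<sigma> \<circ> r)"
      using F[of k] unfolding almost_automorphic_iff P_def by (metis comp_assoc)
  qed
  \<comment> \<open>Only a tail of the diagonal sequence is a subsequence of the one chosen for k.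
    Discarding finitely many terms does not affect limits.\<close>
  have "P k (diagseq \<circ> (+) (Suc k))" for k
    by (rule diagseq_holds) (auto simp: P_def comp_assoc[symmetric] dest: aa_limit_subseq)
  then obtain G where "\<And>k. aa_limit (s \<circ> (diagseq \<circ> (+) (Suc k))) (F k) (G k)"
    unfolding P_def by metis
  then have G: "aa_limit (s \<circ> diagseq) (F k) (G k)" for k
    using LIMSEQ_offset[where k = "Suc k"] by (fastforce simp: aa_limit_def add.commute)
  define \<sigma> where "\<sigma> = s \<circ> diagseq"
  have G1: "(\<lambda>n. F k (t + \<sigma> n)) \<longlonglongrightarrow> G k t" and G2: "(\<lambda>n. G k (t - \<sigma> n)) \<longlonglongrightarrow> F k t" for k t
    using G[of k] by (auto simp: aa_limit_def \<sigma>_def)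
  \<comment> \<open>Only the weak inequality survives the limit, hence the e/2 below.\<close>
  have dist_G: "dist (G k t) (G j t) \<le> e" if "\<And>t. dist (F k t) (F j t) \<le> e" for k j t e
    using that by (intro Lim_bounded[OF tendsto_dist[OF G1 G1], of 0]) auto
  have "uniformly_Cauchy_on UNIV G"
  proof (rule uniformly_Cauchy_onI)
    fix e :: real assume "e > 0"
    then obtain M where M: "\<And>k j t. k \<ge> M \<Longrightarrow> j \<ge> M \<Longrightarrow> dist (F k t) (F j t) < e/2"
      using uniformly_convergent_Cauchy[OF uniformly_convergentI[OF lim]]
      unfolding uniformly_Cauchy_on_def by (metis UNIV_I half_gt_zero)
    have "dist (G k t) (G j t) < e" if "k \<ge> M" "j \<ge> M" for k j t
      using dist_G[of k j "e/2" t] M[OF that] \<open>e > 0\<close> by (force intro: less_imp_le)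
    then show "\<exists>M. \<forall>t\<in>UNIV. \<forall>k\<ge>M. \<forall>j\<ge>M. dist (G k t) (G j t) < e" by blast
  qed
  then obtain g where g: "uniform_limit UNIV G g sequentially"
    using Cauchy_uniformly_convergent uniformly_convergent_on_def by blast
  \<comment> \<open>Interchange of limits, used in both directions: from F to G along
    \<open>t + \<sigma> n\<close>, and from G back to F along \<open>t - \<sigma> n\<close>.\<close>
  have limit: "(\<lambda>n. a (x n)) \<longlonglongrightarrow> b t"
    if A: "uniform_limit UNIV A a sequentially" and B: "uniform_limit UNIV B b sequentially"
      and AB: "\<And>k. (\<lambda>n. A k (x n)) \<longlonglongrightarrow> B k t"
    for A B :: "nat \<Rightarrow> real \<Rightarrow> 'b" and a b t and x :: "nat \<Rightarrow> real"
  proof (rule tendstoI)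
    fix e :: real assume "e > 0"
    then have e3: "e/3 > 0" by simp
    obtain k where k: "\<And>u. dist (A k u) (a u) < e/3" "\<And>u. dist (B k u) (b u) < e/3"
      using eventually_happens'[OF sequentially_bot
          eventually_conj[OF uniform_limitD[OF A e3] uniform_limitD[OF B e3]]] by auto
    show "\<forall>\<^sub>F n in sequentially. dist (a (x n)) (b t) < e"
      using tendstoD[OF AB[of k] e3]
    proof eventually_elim
      case (elim n)
      have "dist (a (x n)) (b t) \<le> dist (A k (x n)) (a (x n)) + dist (A k (x n)) (B k t) + dist (B k t) (b t)"
        by metric
      then show ?case using k(1)[of "x n"] k(2)[of t] elim by simp
    qed
  qed
  have "aa_limit \<sigma> f g"
    unfolding aa_limit_def using limit[OF lim g G1] limit[OF g lim G2] by blast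
  then show "\<exists>\<sigma> :: nat \<Rightarrow> nat. strict_mono \<sigma> \<and> (\<exists>ft. aa_limit (s \<circ> \<sigma>) f ft)"
    using subseq_diagseq unfolding \<sigma>_def by blast
qed

section \<open>Composition with functions depending on a parameter\<close>

text \<open>Compare through \<open>l (p n)\<close>: uniformity absorbs the moving argument of
  \<open>F n\<close>, and continuity of l does the rest.\<close>

lemma tendsto_uniform_limit_moving:
  fixes F :: "nat \<Rightarrow> 'p::metric_space \<Rightarrow> 'b::metric_space"
  assumes F: "uniform_limit B F l sequentially" and l: "continuous_on B l"
    and p: "\<And>n. p n \<in> B" "q \<in> B" "p \<longlonglongrightarrow> q"
  shows "(\<lambda>n. F n (p n)) \<longlonglongrightarrow> l q"
proof (rule tendstoI)
  fix e :: real assume "e > 0"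
  then have e2: "e/2 > 0" by simp
  have "(\<lambda>n. l (p n)) \<longlonglongrightarrow> l q"
    using continuous_on_tendsto_compose[OF l p(3,2)] p(1) by simp
  from tendstoD[OF this e2] uniform_limitD[OF F e2]
  show "\<forall>\<^sub>F n in sequentially. dist (F n (p n)) (l q) < e"
  proof eventually_elim
    case (elim n)
    then show ?case using p(1)[of n] dist_triangle[of "F n (p n)" "l q" "l (p n)"] by force
  qed
qed

text \<open>The limit \<open>pt\<close> stays in the same ball and each \<open>\<Phi>t t\<close> is
  continuous as a uniform limit, so both directions are limits at a moving argument. The family
  \<Phi> covers f as well as the kernel with a fixed time lag.\<close>

lemma aa_limit_compose:
  fixes \<Phi> :: "real \<Rightarrow> 'p::real_normed_vector \<Rightarrow> 'b::metric_space"
  assumes cont: "\<And>t. continuous_on (cball 0 r) (\<Phi> t)"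
    and lim: "\<And>t. uniform_limit (cball 0 r) (\<lambda>n. \<Phi> (t + s n)) (\<Phi>t t) sequentially"
      "\<And>t. uniform_limit (cball 0 r) (\<lambda>n. \<Phi>t (t - s n)) (\<Phi> t) sequentially"
    and p: "aa_limit s p pt" "\<And>t. norm (p t) \<le> r"
  shows "aa_limit s (\<lambda>t. \<Phi> t (p t)) (\<lambda>t. \<Phi>t t (pt t))"
proof -
  have pt: "norm (pt t) \<le> r" for t by (rule aa_limit_norm_le[OF p])
  have "continuous_on (cball 0 r) (\<Phi>t t)" for t
    by (rule uniform_limit_theorem[OF _ lim(1)]) (auto simp: cont)
  then show ?thesis
    unfolding aa_limit_def using p(1)[unfolded aa_limit_def]
    by (auto intro!: tendsto_uniform_limit_moving[OF lim(1)] tendsto_uniform_limit_moving[OF lim(2)]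
        simp: p(2) pt cont)
qed

lemma almost_automorphic_norm_bound:
  assumes "almost_automorphic p"
  obtains r where "\<And>t. norm (p t) \<le> r"
proof -
  have "bounded (range p)" using assms by (simp add: almost_automorphic_def)
  then obtain r where "\<forall>x \<in> range p. norm x \<le> r" unfolding bounded_iff by (rule exE)
  then show ?thesis by (intro that[of r]) simp
qed

text \<open>The range of p lies in a ball, which serves as the bounded parameter set of f. The
  subsequence for f is extracted from one that already works for p.\<close>

lemma almost_automorphic_superposition:
  fixes p :: "real \<Rightarrow> 'y::banach"
  assumes f: "almost_automorphic_param f" and p: "almost_automorphic p"
  shows "almost_automorphic (\<lambda>t. f (t, p t))"
  unfolding almost_automorphic_iff
proof (intro conjI allI)
  have cf: "continuous_on A f" for A
    by (rule continuous_on_subset[of UNIV]) (use f in \<open>simp_all add: almost_automorphic_param_def\<close>)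
  show "continuous_on UNIV (\<lambda>t. f (t, p t))"
    using p by (intro continuous_on_compose2[OF cf[of UNIV]] continuous_intros) (auto simp: almost_automorphic_iff)
  show "bounded (range (\<lambda>t. f (t, p t)))"
    by (rule bounded_subset[of "range f"]) (use f in \<open>auto simp only: almost_automorphic_param_def\<close>)
  fix s :: "nat \<Rightarrow> real"
  obtain r where r: "\<And>t. norm (p t) \<le> r" using almost_automorphic_norm_bound[OF p] by blast
  obtain \<sigma> pt where \<sigma>: "strict_mono \<sigma>" "aa_limit (s \<circ> \<sigma>) p pt"
    using p unfolding almost_automorphic_iff by blast
  obtain \<rho> ft where \<rho>: "strict_mono \<rho>"
    and lim: "\<And>t. uniform_limit (cball 0 r) (\<lambda>n x. f (t + (s \<circ> \<sigma>) (\<rho> n), x)) (\<lambda>x. ft (t, x)) sequentially"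
    "\<And>t. uniform_limit (cball 0 r) (\<lambda>n x. ft (t - (s \<circ> \<sigma>) (\<rho> n), x)) (\<lambda>x. f (t, x)) sequentially"
    using f[unfolded almost_automorphic_param_def] bounded_cball[of "0::'y" r] by metis
  have "aa_limit (s \<circ> (\<sigma> \<circ> \<rho>)) (\<lambda>t. f (t, p t)) (\<lambda>t. ft (t, pt t))"
  proof (rule aa_limit_compose[where \<Phi> = "\<lambda>t x. f (t, x)" and \<Phi>t = "\<lambda>t x. ft (t, x)" and r = r])
    show "continuous_on (cball 0 r) (\<lambda>x. f (t, x))" for t
      by (intro continuous_on_compose2[OF cf[of UNIV]] continuous_intros) auto
    show "aa_limit (s \<circ> (\<sigma> \<circ> \<rho>)) p pt"
      using aa_limit_subseq[OF \<sigma>(2) \<rho>(1)] by (simp add: comp_assoc)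
  qed (use lim r in auto)
  then show "\<exists>\<sigma> :: nat \<Rightarrow> nat. strict_mono \<sigma> \<and> (\<exists>ft. aa_limit (s \<circ> \<sigma>) (\<lambda>t. f (t, p t)) ft)"
    using strict_mono_o[OF \<sigma>(1) \<rho>] by blast
qed

section \<open>The kernel integral of an almost automorphic function\<close>

lemma almost_automorphic_kernel_integral:
  fixes C :: "real \<times> real \<times> 'a \<times> 'a \<Rightarrow> 'a::banach"
  assumes C: "bi_almost_automorphic C" and lam: "lambda_bounded lam C" "lam 0 integrable_on {..0}"
    and p: "almost_automorphic p"
  shows "(\<lambda>s. C (t, s, p s)) integrable_on {..t}"
    and "norm (integral {..t} (\<lambda>s. C (t, s, p s))) \<le> integral {..0} (lam 0)"
    and "almost_automorphic (\<lambda>t. integral {..t} (\<lambda>s. C (t, s, p s)))"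
proof -
  \<comment> \<open>The substitution makes the domain \<open>{..0}\<close> for every t, so that t
    enters only through the integrand.\<close>
  define g where "g t s = C (t, s + t, p (s + t))" for t s
  have cC: "continuous_on UNIV C" using C by (simp add: bi_almost_automorphic_def)
  have cp: "continuous_on A p" for A
    by (rule continuous_on_subset[of UNIV]) (use p in \<open>simp_all add: almost_automorphic_def\<close>)
  have cont2: "continuous_on UNIV (\<lambda>(t, s). g t s)"
    unfolding g_def case_prod_unfold
    by (intro continuous_on_compose2[OF cC] continuous_intros continuous_on_compose2[OF cp[of UNIV]]) auto
  have cont: "continuous_on A (g t)" for A t
    using continuous_on_compose2[OF cont2, of A "\<lambda>s. (t, s)"] by (simp add: continuous_intros)
  have cont': "continuous_on UNIV (\<lambda>t. g t s)" for s
    using continuous_on_compose2[OF cont2, of UNIV "\<lambda>t. (t, s)"] by (simp add: continuous_intros)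
  have le: "norm (g t s) \<le> lam 0 s" for t s
  proof -
    \<comment> \<open>As the bound is the same for all bounded sets, a singleton suffices. The pair
      of times is (0, s) shifted by t.\<close>
    have "bounded {p (s + t)}" by simp
    then have "\<forall>(x, y) \<in> {p (s + t)}. norm (C (0 + t, s + t, x, y)) \<le> lam 0 s"
      using lam(1) unfolding lambda_bounded_def by blast
    then show ?thesis by (simp add: g_def case_prod_unfold)
  qed
  have int: "g t integrable_on {..0}" for t
    by (rule integrable_continuous_dominated_atMost[OF cont lam(2) le])
  have has: "((\<lambda>s. C (t, s, p s)) has_integral integral {..0} (g t)) {..t}" for t
    by (rule has_integral_shift_atMost) (unfold g_def[symmetric], rule integrable_integral[OF int])
  then show "(\<lambda>s. C (t, s, p s)) integrable_on {..t}" by blast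
  have eq: "integral {..t} (\<lambda>s. C (t, s, p s)) = integral {..0} (g t)" for t
    using has by (rule integral_unique)
  have bound: "norm (integral {..0} (g t)) \<le> integral {..0} (lam 0)" for t
    by (rule integral_norm_bound_integral[OF int lam(2) le])
  then show "norm (integral {..t} (\<lambda>s. C (t, s, p s))) \<le> integral {..0} (lam 0)"
    by (simp add: eq)
  show "almost_automorphic (\<lambda>t. integral {..t} (\<lambda>s. C (t, s, p s)))"
    unfolding eq almost_automorphic_iff
  proof (intro conjI allI)
    \<comment> \<open>Here the limit integrand \<open>g a\<close> is itself continuous, so
      vector-valued dominated convergence applies directly.\<close>
    show "continuous_on UNIV (\<lambda>t. integral {..0} (g t))"
    proof (rule continuous_on_sequentiallyI)
      fix u and a :: real assume "u \<longlonglongrightarrow> a"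
      then show "(\<lambda>n. integral {..0} (g (u n))) \<longlonglongrightarrow> integral {..0} (g a)"
        by (intro integral_tendsto_dominated_atMost[OF cont cont lam(2) le]
            continuous_on_tendsto_compose[OF cont']) auto
    qed
    show "bounded (range (\<lambda>t. integral {..0} (g t)))"
      using bound by (auto simp: bounded_iff)
    fix s' :: "nat \<Rightarrow> real"
    obtain r where r: "\<And>t. norm (p t) \<le> r" using almost_automorphic_norm_bound[OF p] by blast
    obtain \<sigma> pt where \<sigma>: "strict_mono \<sigma>" "aa_limit (s' \<circ> \<sigma>) p pt"
      using p unfolding almost_automorphic_iff by blast
    obtain \<rho> Ct where \<rho>: "strict_mono \<rho>" and lim: "limit_function_on (cball 0 r) ((s' \<circ> \<sigma>) \<circ> \<rho>) C Ct"
      using C unfolding bi_almost_automorphic_def by (meson bounded_cball)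
    define \<tau> where "\<tau> = (s' \<circ> \<sigma>) \<circ> \<rho>"
    have \<tau>: "aa_limit \<tau> p pt" unfolding \<tau>_def by (rule aa_limit_subseq[OF \<sigma>(2) \<rho>])
    \<comment> \<open>For fixed lag s, translating t moves both time arguments of C equally, which
      is the shift in bi-almost automorphy.\<close>
    have "aa_limit \<tau> (\<lambda>t. g t s) (\<lambda>t. Ct (t, s + t, pt (s + t)))" for s
      unfolding g_def
    proof (rule aa_limit_compose[where \<Phi> = "\<lambda>t q. C (t, s + t, q)" and p = "\<lambda>t. p (s + t)"
          and \<Phi>t = "\<lambda>t q. Ct (t, s + t, q)" and pt = "\<lambda>t. pt (s + t)" and r = r])
      show "continuous_on (cball 0 r) (\<lambda>q. C (t, s + t, q))" for t
        by (intro continuous_on_compose2[OF cC] continuous_intros) auto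
      show "uniform_limit (cball 0 r) (\<lambda>n q. C (t + \<tau> n, s + (t + \<tau> n), q))
          (\<lambda>q. Ct (t, s + t, q)) sequentially" for t
        using lim by (simp add: limit_function_on_def \<tau>_def add.assoc[symmetric])
      have "uniform_limit (cball 0 r) (\<lambda>n q. Ct (t - \<tau> n, (s + t) - \<tau> n, q))
          (\<lambda>q. C (t, s + t, q)) sequentially" for t
        using lim by (simp add: limit_function_on_def \<tau>_def)
      then show "uniform_limit (cball 0 r) (\<lambda>n q. Ct (t - \<tau> n, s + (t - \<tau> n), q))
          (\<lambda>q. C (t, s + t, q)) sequentially" for t
        by (simp add: add_diff_eq)
      show "aa_limit \<tau> (\<lambda>t. p (s + t)) (\<lambda>t. pt (s + t))"
        using \<tau> by (simp add: aa_limit_def add.assoc[symmetric] add_diff_eq)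
    qed (rule r)
    from aa_limit_integral[OF cont lam(2) le this]
    show "\<exists>\<sigma> :: nat \<Rightarrow> nat. strict_mono \<sigma> \<and> (\<exists>ft. aa_limit (s' \<circ> \<sigma>) (\<lambda>t. integral {..0} (g t)) ft)"
      using strict_mono_o[OF \<sigma>(1) \<rho>] unfolding \<tau>_def comp_assoc by blast
  qed
qed

section \<open>The fixed point argument\<close>

lemma kernel_constant_ge:
  assumes "is_kernel_constant k c"
  shows "integral {..t} (k t) \<le> c"
  using assms cSUP_upper[of t UNIV "\<lambda>t. integral {..t} (k t)"] by (auto simp: is_kernel_constant_def)

text \<open>Convergence of bounded continuous functions in the supremum metric is uniform, so almost
  automorphy and the bound pass to limits. Closedness in the complete ambient space is
  enough.\<close>

lemma complete_almost_automorphic_ball: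
  "complete {\<phi> :: real \<Rightarrow>\<^sub>C 'a::banach. almost_automorphic \<phi> \<and> (\<forall>t. norm (\<phi> t) \<le> r)}" (is "complete ?S")
  unfolding complete_eq_closed closed_sequential_limits
proof (intro allI impI, elim conjE)
  fix F :: "nat \<Rightarrow> real \<Rightarrow>\<^sub>C 'a" and \<phi> assume F: "\<forall>n. F n \<in> ?S" and "F \<longlonglongrightarrow> \<phi>"
  then have lim: "uniform_limit UNIV (\<lambda>n. apply_bcontfun (F n)) \<phi> sequentially"
    by (intro tendsto_bcontfun_uniform_limit)
  have "almost_automorphic \<phi>"
    by (rule almost_automorphic_uniform_limit[OF _ lim]) (use F in blast)
  moreover have "norm (\<phi> t) \<le> r" for t
    using tendsto_uniform_limitI[OF lim UNIV_I[of t]]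
    by (rule Lim_norm_ubound[OF sequentially_bot]) (use F in auto)
  ultimately show "\<phi> \<in> ?S" by blast
qed

text \<open>A contraction on the ball of radius r says nothing about larger solutions, so uniqueness
  is asserted inside balls of admissible radius. Globally it can fail: for
  \<open>C\<^sub>1 = 0\<close>, small \<open>\<alpha>\<^sub>1\<close> and a suitable real f
  depending only on x, with f = 0 for |x| \<le> 1 and f = 2 at x = 2, the constants 0 and 2 both
  solve the equation. The supremum is taken in \<open>ereal\<close> because it may be
  infinite.\<close>

theorem theorem3p7:
  fixes f :: "real \<times> 'a::banach \<times> 'a \<Rightarrow> 'a"
    and C\<^sub>1 :: "real \<times> real \<times> 'a \<times> 'a \<Rightarrow> 'a"
    and h\<^sub>0 h\<^sub>1 :: "real \<Rightarrow> real"
    and L\<^sub>f :: "real \<Rightarrow> real"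
    and \<alpha>\<^sub>1 N\<^sub>1 :: real
  assumes h0: "\<And>y :: real \<Rightarrow> 'a. almost_automorphic y \<Longrightarrow> almost_automorphic (\<lambda>t. y (h\<^sub>0 t))"
    and h1: "\<And>y :: real \<Rightarrow> 'a. almost_automorphic y \<Longrightarrow> almost_automorphic (\<lambda>t. y (h\<^sub>1 t))"
    and C1: "admissible_kernel C\<^sub>1 \<alpha>\<^sub>1 N\<^sub>1"
    and f: "almost_automorphic_param f"
    and Lf: "continuous_on {0..} L\<^sub>f" "bounded (L\<^sub>f ` {0..})" "\<And>r. 0 \<le> r \<Longrightarrow> 0 \<le> L\<^sub>f r"
    and f_lip: "\<And>r t x y x1 y1. 0 < r \<Longrightarrow>
        x \<in> cball 0 r \<Longrightarrow> y \<in> cball 0 r \<Longrightarrow> x1 \<in> cball 0 r \<Longrightarrow> y1 \<in> cball 0 r \<Longrightarrow>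
        norm (f (t, x, x1) - f (t, y, y1)) \<le> L\<^sub>f r * (norm (x - y) + norm (x1 - y1))"
    and sup: "(SUP r\<in>{0<..}. ereal (r - 2 * r * L\<^sub>f r - 2 * r * N\<^sub>1))
        > ereal (\<alpha>\<^sub>1 + (SUP s. norm (f (s, 0, 0))))"
  shows "(\<exists>y. almost_automorphic y \<and> solves_integral_equation f C\<^sub>1 h\<^sub>0 h\<^sub>1 y) \<and>
    (\<forall>r>0. r - 2 * r * L\<^sub>f r - 2 * r * N\<^sub>1 > \<alpha>\<^sub>1 + (SUP s. norm (f (s, 0, 0))) \<longrightarrow>
      (\<exists>!y. almost_automorphic y \<and> solves_integral_equation f C\<^sub>1 h\<^sub>0 h\<^sub>1 y \<and>
            (\<forall>t. norm (y t) \<le> r)))"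
proof -
  obtain lam \<mu> \<mu>t where aaC: "bi_almost_automorphic C\<^sub>1" and lam: "lambda_bounded lam C\<^sub>1"
    and lip: "mu_lipschitz \<mu> \<mu>t C\<^sub>1" and \<alpha>: "is_kernel_constant lam \<alpha>\<^sub>1" and N: "is_kernel_constant \<mu> N\<^sub>1"
    using C1 unfolding admissible_kernel_def by blast
  have lam_int: "lam t integrable_on {..t}" and \<mu>_int: "\<mu> t integrable_on {..t}" for t
    using \<alpha> N by (auto simp: is_kernel_constant_def)
  have lam_pos: "0 \<le> lam t s" and \<mu>_nonneg: "0 \<le> \<mu> t s" for t s
    using lam lip by (auto simp: lambda_bounded_def mu_lipschitz_def less_imp_le)
  have \<alpha>_nonneg: "0 \<le> \<alpha>\<^sub>1"
    using integral_nonneg[OF lam_int lam_pos] kernel_constant_ge[OF \<alpha>] by (rule order_trans)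
  have N_nonneg: "0 \<le> N\<^sub>1"
    using integral_nonneg[OF \<mu>_int \<mu>_nonneg] kernel_constant_ge[OF N] by (rule order_trans)
  define F where "F = (SUP s. norm (f (s, 0, 0)))"
  have F: "norm (f (t, 0, 0)) \<le> F" for t
  proof -
    have "bounded (range f)" using f by (simp add: almost_automorphic_param_def)
    then obtain b where "\<forall>x \<in> range f. norm x \<le> b" unfolding bounded_iff by (rule exE)
    then have "bdd_above (range (\<lambda>s. norm (f (s, 0, 0))))" by (intro bdd_aboveI[of _ b]) auto
    then show ?thesis unfolding F_def by (intro cSUP_upper) auto
  qed
  have F_nonneg: "0 \<le> F" using norm_ge_zero F[of 0] by (rule order_trans)
  define K where "K y t = integral {..t} (\<lambda>s. C\<^sub>1 (t, s, y s, y (h\<^sub>1 s)))" for y t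
  define \<Gamma> where "\<Gamma> y t = f (t, y t, y (h\<^sub>0 t)) + K y t" for y t
  have K_int: "(\<lambda>s. C\<^sub>1 (t, s, y s, y (h\<^sub>1 s))) integrable_on {..t}" and K_le: "norm (K y t) \<le> \<alpha>\<^sub>1"
    and K_aa: "almost_automorphic (K y)" if y: "almost_automorphic y" for y t
  proof -
    note * = almost_automorphic_kernel_integral[OF aaC lam lam_int almost_automorphic_Pair[OF y h1[OF y]]]
    show "(\<lambda>s. C\<^sub>1 (t, s, y s, y (h\<^sub>1 s))) integrable_on {..t}" by (rule *(1))
    show "norm (K y t) \<le> \<alpha>\<^sub>1" unfolding K_def using *(2) kernel_constant_ge[OF \<alpha>] by (rule order_trans)
    show "almost_automorphic (K y)" unfolding K_def by (rule *(3))
  qed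
  have \<Gamma>_aa: "almost_automorphic (\<Gamma> y)" if y: "almost_automorphic y" for y
    unfolding \<Gamma>_def
    by (intro almost_automorphic_add K_aa y almost_automorphic_superposition[OF f]
        almost_automorphic_Pair h0)
  \<comment> \<open>For almost automorphic y the integrability demanded of a solution is
    automatic.\<close>
  have solves_iff: "solves_integral_equation f C\<^sub>1 h\<^sub>0 h\<^sub>1 y \<longleftrightarrow> y = \<Gamma> y" if "almost_automorphic y" for y
    using K_int[OF that] by (auto simp: solves_integral_equation_def \<Gamma>_def K_def fun_eq_iff)
  have main: "\<exists>!y. almost_automorphic y \<and> solves_integral_equation f C\<^sub>1 h\<^sub>0 h\<^sub>1 y \<and> (\<forall>t. norm (y t) \<le> r)"
    if r: "r > 0" and gap: "r - 2 * r * L\<^sub>f r - 2 * r * N\<^sub>1 > \<alpha>\<^sub>1 + F" for r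
  proof -
    have L_nonneg: "0 \<le> L\<^sub>f r" using Lf(3) r by simp
    \<comment> \<open>The factor 2 appears because f and the kernel each depend on y through two
      arguments, the present and the deviated one.\<close>
    define c where "c = 2 * (L\<^sub>f r + N\<^sub>1)"
    have c0: "0 \<le> c" using L_nonneg N_nonneg by (simp add: c_def)
    have "0 < r * (1 - c)" using gap \<alpha>_nonneg F_nonneg by (simp add: c_def algebra_simps)
    then have c1: "c < 1" using r by (simp add: zero_less_mult_iff)
    \<comment> \<open>Comparing f with its value at the origin bounds it by
      \<open>F + 2 * r * L\<^sub>f r\<close>; the integral adds at most
      \<open>\<alpha>\<^sub>1\<close>.\<close>
    have \<Gamma>_le: "norm (\<Gamma> y t) \<le> r" if y: "almost_automorphic y" "\<And>t. norm (y t) \<le> r" for y t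
    proof -
      have "norm (f (t, y t, y (h\<^sub>0 t)) - f (t, 0, 0)) \<le> L\<^sub>f r * (norm (y t - 0) + norm (y (h\<^sub>0 t) - 0))"
        using r y(2) by (intro f_lip) auto
      also have "\<dots> \<le> L\<^sub>f r * (r + r)"
        using y(2)[of t] y(2)[of "h\<^sub>0 t"] L_nonneg by (intro mult_left_mono) auto
      finally have "norm (f (t, y t, y (h\<^sub>0 t))) \<le> F + 2 * r * L\<^sub>f r"
        using F[of t] norm_triangle_sub[of "f (t, y t, y (h\<^sub>0 t))" "f (t, 0, 0)"] by (simp add: algebra_simps)
      then have "norm (\<Gamma> y t) \<le> F + 2 * r * L\<^sub>f r + \<alpha>\<^sub>1"
        unfolding \<Gamma>_def using K_le[OF y(1), of t] norm_triangle_mono by blast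
      moreover have "0 \<le> 2 * r * N\<^sub>1" using r N_nonneg by simp
      ultimately show ?thesis using gap by linarith
    qed
    have \<Gamma>_contr: "norm (\<Gamma> y t - \<Gamma> z t) \<le> c * d"
      if y: "almost_automorphic y" "\<And>t. norm (y t) \<le> r" and z: "almost_automorphic z" "\<And>t. norm (z t) \<le> r"
        and d: "\<And>t. norm (y t - z t) \<le> d" for y z d t
    proof -
      have d0: "0 \<le> d" using norm_ge_zero d by (rule order_trans)
      have "norm (f (t, y t, y (h\<^sub>0 t)) - f (t, z t, z (h\<^sub>0 t))) \<le>
          L\<^sub>f r * (norm (y t - z t) + norm (y (h\<^sub>0 t) - z (h\<^sub>0 t)))"
        using r y(2) z(2) by (intro f_lip) auto
      also have "\<dots> \<le> L\<^sub>f r * (d + d)"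
        using d L_nonneg by (intro mult_left_mono add_mono) auto
      finally have 1: "norm (f (t, y t, y (h\<^sub>0 t)) - f (t, z t, z (h\<^sub>0 t))) \<le> L\<^sub>f r * (d + d)" .
      have lipC: "norm (C\<^sub>1 (t, s, u1, u2) - C\<^sub>1 (t, s, v1, v2)) \<le> \<mu> t s * (norm (u1 - v1) + norm (u2 - v2))"
        for s u1 u2 v1 v2
      proof -
        \<comment> \<open>Since \<mu> does not depend on the bounded set, the two points compared
          can form that set.\<close>
        have "bounded {(u1, u2), (v1, v2)}" by simp
        from lip[unfolded mu_lipschitz_def, THEN conjunct2, THEN conjunct2, THEN spec, THEN mp, OF this,
            THEN conjunct1, THEN spec, THEN spec, of t s]
        show ?thesis by simp
      qed
      have "norm (K y t - K z t) \<le> integral {..t} (\<lambda>s. (d + d) * \<mu> t s)"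
        unfolding K_def
      proof (subst integral_diff[symmetric, OF K_int K_int])
        show "norm (integral {..t} (\<lambda>s. C\<^sub>1 (t, s, y s, y (h\<^sub>1 s)) - C\<^sub>1 (t, s, z s, z (h\<^sub>1 s)))) \<le>
            integral {..t} (\<lambda>s. (d + d) * \<mu> t s)"
        proof (intro integral_norm_bound_integral integrable_diff K_int y z integrable_on_mult_right \<mu>_int)
          fix s
          have "\<mu> t s * (norm (y s - z s) + norm (y (h\<^sub>1 s) - z (h\<^sub>1 s))) \<le> \<mu> t s * (d + d)"
            using d \<mu>_nonneg by (intro mult_left_mono add_mono) auto
          with lipC show "norm (C\<^sub>1 (t, s, y s, y (h\<^sub>1 s)) - C\<^sub>1 (t, s, z s, z (h\<^sub>1 s))) \<le> (d + d) * \<mu> t s"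
            by (subst mult.commute) (rule order_trans)
        qed
      qed (fact y z)+
      also have "\<dots> \<le> (d + d) * N\<^sub>1"
        using kernel_constant_ge[OF N, of t] d0 by (simp add: mult_left_mono)
      finally have 2: "norm (K y t - K z t) \<le> (d + d) * N\<^sub>1" .
      have "norm (\<Gamma> y t - \<Gamma> z t) \<le> L\<^sub>f r * (d + d) + (d + d) * N\<^sub>1"
        unfolding \<Gamma>_def add_diff_add using 1 2 by (rule norm_triangle_mono)
      then show ?thesis by (simp add: c_def algebra_simps)
    qed
    define S where "S = {\<phi> :: real \<Rightarrow>\<^sub>C 'a. almost_automorphic \<phi> \<and> (\<forall>t. norm (\<phi> t) \<le> r)}"
    \<comment> \<open>\<open>Bcontfun\<close> can be inverted only at bounded continuous functions,
      so T is identified with \<Gamma> only on S, where \<open>\<Gamma>_aa\<close> supplies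
      this.\<close>
    define T :: "(real \<Rightarrow>\<^sub>C 'a) \<Rightarrow> real \<Rightarrow>\<^sub>C 'a" where "T \<phi> = Bcontfun (\<Gamma> \<phi>)" for \<phi>
    have apply_Bcontfun: "apply_bcontfun (Bcontfun y) = y" if "almost_automorphic y" for y :: "real \<Rightarrow> 'a"
      using that by (intro Bcontfun_inverse) (simp add: bcontfun_def almost_automorphic_def)
    have T: "apply_bcontfun (T \<phi>) = \<Gamma> \<phi>" if "\<phi> \<in> S" for \<phi>
      using that by (simp add: T_def S_def apply_Bcontfun \<Gamma>_aa)
    have "\<exists>!\<phi> \<in> S. T \<phi> = \<phi>"
    proof (rule Banach_fix[OF _ _ c0 c1])
      show "complete S" unfolding S_def by (rule complete_almost_automorphic_ball)
      have "Bcontfun (\<lambda>_. 0) \<in> S"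
        using r by (simp add: S_def apply_Bcontfun almost_automorphic_const)
      then show "S \<noteq> {}" by blast
      show "T ` S \<subseteq> S"
      proof
        fix \<psi> assume "\<psi> \<in> T ` S"
        then obtain \<phi> where "\<phi> \<in> S" "\<psi> = T \<phi>" by blast
        then show "\<psi> \<in> S" using T[of \<phi>] \<Gamma>_aa \<Gamma>_le by (simp add: S_def)
      qed
      show "dist (T \<phi>) (T \<psi>) \<le> c * dist \<phi> \<psi>" if "\<phi> \<in> S" "\<psi> \<in> S" for \<phi> \<psi>
      proof (rule dist_bound)
        fix t
        show "dist (T \<phi> t) (T \<psi> t) \<le> c * dist \<phi> \<psi>"
          unfolding T[OF that(1)] T[OF that(2)] dist_norm
          using that dist_bounded[of \<phi> _ \<psi>] by (intro \<Gamma>_contr) (auto simp: S_def dist_norm)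
      qed
    qed
    then obtain \<phi> where \<phi>: "\<phi> \<in> S" "T \<phi> = \<phi>" and unique: "\<forall>\<psi>. \<psi> \<in> S \<and> T \<psi> = \<psi> \<longrightarrow> \<psi> = \<phi>"
      by (elim ex1E conjE) (rule that)
    show ?thesis
    proof (rule ex1I[of _ "apply_bcontfun \<phi>"])
      have "apply_bcontfun \<phi> = \<Gamma> \<phi>" using T[OF \<phi>(1)] \<phi>(2) by simp
      then show "almost_automorphic \<phi> \<and> solves_integral_equation f C\<^sub>1 h\<^sub>0 h\<^sub>1 \<phi> \<and> (\<forall>t. norm (\<phi> t) \<le> r)"
        using \<phi>(1) solves_iff[of \<phi>] by (simp add: S_def)
    next
      \<comment> \<open>A competing solution in the ball lifts to a fixed point of T in S.\<close>
      fix y assume y: "almost_automorphic y \<and> solves_integral_equation f C\<^sub>1 h\<^sub>0 h\<^sub>1 y \<and> (\<forall>t. norm (y t) \<le> r)"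
      then have "\<Gamma> y = y" using solves_iff[of y] by simp
      moreover have app: "apply_bcontfun (Bcontfun y) = y" using y by (simp add: apply_Bcontfun)
      ultimately have "Bcontfun y = \<phi>"
        using y by (intro unique[rule_format]) (simp_all add: S_def T_def)
      then show "y = \<phi>" using app by simp
    qed
  qed
  obtain r where r: "r > 0" "r - 2 * r * L\<^sub>f r - 2 * r * N\<^sub>1 > \<alpha>\<^sub>1 + F"
    using sup unfolding F_def[symmetric] less_SUP_iff by auto
  have "\<exists>y. almost_automorphic y \<and> solves_integral_equation f C\<^sub>1 h\<^sub>0 h\<^sub>1 y"
    using ex1_implies_ex[OF main[OF r]] by (elim exE conjE) (intro exI conjI)
  with main show ?thesis unfolding F_def[symmetric] by simp
qed

end
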